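(* Let $y^*=\arg\max_{y\in\mathcal{Y}}\Phi(y)$, $\hat H=\max_y h(y)$, $\hat G=\max_y g(y)$, and assume $\Phi(y^* )>\phi$. Then angular search (the algorithm described in the context) with $$\lambda_0=\frac{\hat G}{\hat H},\qquad \alpha_0=\frac{\hat G^2}{\phi},\qquad \beta_0=\frac{\phi}{\hat H^2}$$ finds an $\epsilon$-optimal solution, $\Phi(y)\ge(1-\epsilon)\Phi(y^* )$, in $T$ queries and $O(T)$ operations, where $$T=4\log\left(\frac{\hat G\hat H}{\phi}\right)\cdot\frac1\epsilon,$$ and a $\delta$-optimal solution, $\Phi(y)\ge\Phi(y^* )-\delta$, in $T'$ queries and $O(T')$ operations, where $$T'=4\log\left(\frac{\hat G\hat H}{\phi}\right)\cdot\frac{\Phi(y^* )}{\delta}.$$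
   Context: $\mathcal{Y}$ is a set of labels, $h:\mathcal{Y}\to\mathbb{R}$, $g:\mathcal{Y}\to[0,\infty)$, $\Phi(y)=h(y)g(y)$, and $\phi>0$. For a vector $a=(a_1,a_2)$ write $\partial(a)=a_2/a_1$ for its slope. Constrained $\lambda$-oracle: $\mathcal{O}_c(\lambda,\alpha,\beta)$ returns a maximizer of $h(y)+\lambda g(y)$ over the labels $y\in\mathcal{Y}$ with $\alpha h(y)\ge g(y)$ and $\beta h(y)<g(y)$. The variant $\underline{\mathcal{O}}_c(\lambda,\alpha,\beta)$ is the same with the place of the equality swapped, i.e. over the labels with $\alpha h(y)>g(y)$ and $\beta h(y)\le g(y)$. Each returns $\emptyset$ if there is no such label. A query is one call to the oracle. Angular search with initial values $\lambda_0,\alpha_0,\beta_0$ and a maximum iteration number: initialize $\lambda=\lambda_0$, $\hat y=\emptyset$, and a queue containing only $(\alpha_0,\beta_0,0)$. While the queue is nonempty, perform an iteration: (1) Dequeue $(\alpha,\beta,s)$. If $\beta\ne0$, set $\lambda=1/\sqrt{\alpha\beta}$ (otherwise $\lambda$ is unchanged). (2) Let $y=\mathcal{O}_c(\lambda,\alpha,\beta)$ if $s=0$ and $y=\underline{\mathcal{O}}_c(\lambda,\alpha,\beta)$ otherwise. If $y$ is a label with $\Phi(y)>\Phi(\hat y)$ (or $\hat y=\emptyset$), set $\hat y=y$. (3) If $y\ne\emptyset$, let $z=(h(y),g(y))$, $z'=(\lambda g(y),\frac1\lambda h(y))$ and $r=(\sqrt{\lambda h(y)g(y)},\sqrt{\frac1\lambda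 h(y)g(y)})$. If $z_1=z'_1$, return $y$. Otherwise, if $\partial(z)>\partial(z')$, enqueue $(\partial(z),\partial(r),1)$ and $(\partial(r),\partial(z'),0)$; else enqueue $(\partial(z'),\partial(r),1)$ and $(\partial(r),\partial(z),0)$. (4) If the maximum number of iterations has been made, return $\hat y$. When the queue is empty the output is $\hat y$.
   Formalization: "If z_1=z'_1, return y" is read as: do not split this cone, go on with the remaining queue (returning y at once can miss the optimum); and T, T' are replaced by max(1,T), max(1,T') in the query and operation bounds, since nothing can be found with 0 queries. *)

theory Defs
  imports Complex_Main "HOL-Library.Monad_Syntax"
begin

definition Phi :: "('y \<Rightarrow> real) \<Rightarrow> ('y \<Rightarrow> real) \<Rightarrow> 'y \<Rightarrow> real" where
  "Phi h g y = h y * g y"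

definition slope :: "real \<times> real \<Rightarrow> real" where
  "slope a = snd a / fst a"

definition cone :: "'y set \<Rightarrow> ('y \<Rightarrow> real) \<Rightarrow> ('y \<Rightarrow> real) \<Rightarrow> real \<Rightarrow> real \<Rightarrow> 'y set" where
  "cone Y h g \<alpha> \<beta> = {y \<in> Y. \<alpha> * h y \<ge> g y \<and> \<beta> * h y < g y}"

definition cone_swapped :: "'y set \<Rightarrow> ('y \<Rightarrow> real) \<Rightarrow> ('y \<Rightarrow> real) \<Rightarrow> real \<Rightarrow> real \<Rightarrow> 'y set" where
  "cone_swapped Y h g \<alpha> \<beta> = {y \<in> Y. \<alpha> * h y > g y \<and> \<beta> * h y \<le> g y}"

type_synonym 'y cone_oracle = "real \<Rightarrow> real \<Rightarrow> real \<Rightarrow> 'y option"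

(* Ties between maximizers may be broken arbitrarily; None is the answer "no such label".
   For infinite Y this includes the assumption that the maxima exist. *)
definition lambda_oracle ::
    "(real \<Rightarrow> real \<Rightarrow> 'y set) \<Rightarrow> ('y \<Rightarrow> real) \<Rightarrow> ('y \<Rightarrow> real) \<Rightarrow> 'y cone_oracle \<Rightarrow> bool" where
  "lambda_oracle F h g ora \<longleftrightarrow>
     (\<forall>lam \<alpha> \<beta>. case ora lam \<alpha> \<beta> of
        None \<Rightarrow> F \<alpha> \<beta> = {}
      | Some y \<Rightarrow> is_arg_max (\<lambda>y. h y + lam * g y) (\<lambda>y. y \<in> F \<alpha> \<beta>) y)"

(* A computation carries its result, the number of queries and the number of
   operations.  The operations are arithmetic operations, square roots, comparisons,
   evaluations of h and g, assignments, queue operations and queries; each counts 1,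
   so the work done to answer a query is not counted. *)
datatype 'a comp = Comp (outcome: 'a) (queries: nat) (operations: nat)

definition ret :: "'a \<Rightarrow> 'a comp" where
  "ret x = Comp x 0 0"

definition op1 :: "'a \<Rightarrow> 'a comp" where
  "op1 x = Comp x 0 1"

definition query :: "'a \<Rightarrow> 'a comp" where
  "query x = Comp x 1 1"

definition bind_comp :: "'a comp \<Rightarrow> ('a \<Rightarrow> 'b comp) \<Rightarrow> 'b comp" where
  "bind_comp c f =
     (let d = f (outcome c)
      in Comp (outcome d) (queries c + queries d) (operations c + operations d))"

adhoc_overloading
  Monad_Syntax.bind \<rightleftharpoons> bind_comp

type_synonym 'y state = "(real \<times> real \<times> nat) list \<times> real \<times> 'y option"

definition improves :: "('y \<Rightarrow> real) \<Rightarrow> ('y \<Rightarrow> real) \<Rightarrow> 'y \<Rightarrow> 'y option \<Rightarrow> bool comp" where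
  "improves h g y best =
     (case best of
        None \<Rightarrow> op1 True
      | Some b \<Rightarrow> do {
          hy \<leftarrow> op1 (h y); gy \<leftarrow> op1 (g y); p \<leftarrow> op1 (hy * gy);
          hb \<leftarrow> op1 (h b); gb \<leftarrow> op1 (g b); q \<leftarrow> op1 (hb * gb);
          op1 (p > q)
        })"

(* The points z, z' and r of a label y. *)
definition points :: "('y \<Rightarrow> real) \<Rightarrow> ('y \<Rightarrow> real) \<Rightarrow> real \<Rightarrow> 'y \<Rightarrow>
    ((real \<times> real) \<times> (real \<times> real) \<times> (real \<times> real)) comp" where
  "points h g lam y = do {
     a \<leftarrow> op1 (h y);
     b \<leftarrow> op1 (g y);
     i \<leftarrow> op1 (1 / lam);
     c \<leftarrow> op1 (lam * b);
     d \<leftarrow> op1 (i * a);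
     u \<leftarrow> op1 (lam * a); u \<leftarrow> op1 (u * b); u \<leftarrow> op1 (sqrt u);
     v \<leftarrow> op1 (i * a); v \<leftarrow> op1 (v * b); v \<leftarrow> op1 (sqrt v);
     ret ((a, b), (c, d), (u, v))
   }"

(* One iteration, on a state with nonempty queue.  When fst z = fst z', the label y maximizes
   Phi over the cone (alpha, beta) that was just queried, and the cone is finished: it is not
   split further.  The search itself goes on with the cones left in the queue, since these
   may contain labels with a larger Phi.  For the initial cone the queue is empty at this
   point, so there the search ends and returns y. *)
definition iteration ::
    "('y \<Rightarrow> real) \<Rightarrow> ('y \<Rightarrow> real) \<Rightarrow> 'y cone_oracle \<Rightarrow> 'y cone_oracle \<Rightarrow> 'y state \<Rightarrow> 'y state comp" where
  "iteration h g Oc Ou = (\<lambda>(Q, lam, best). do {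
     ((\<alpha>, \<beta>, s), Q) \<leftarrow> op1 (hd Q, tl Q);
     nz \<leftarrow> op1 (\<beta> \<noteq> 0);
     lam \<leftarrow> (if nz then do { p \<leftarrow> op1 (\<alpha> * \<beta>); q \<leftarrow> op1 (sqrt p); op1 (1 / q) } else ret lam);
     s0 \<leftarrow> op1 (s = 0);
     answer \<leftarrow> query (if s0 then Oc lam \<alpha> \<beta> else Ou lam \<alpha> \<beta>);
     case answer of
       None \<Rightarrow> ret (Q, lam, best)
     | Some y \<Rightarrow> do {
         better \<leftarrow> improves h g y best;
         best \<leftarrow> (if better then op1 (Some y) else ret best);
         (z, z', r) \<leftarrow> points h g lam y;
         tie \<leftarrow> op1 (fst z = fst z');
         if tie then ret (Q, lam, best)
         else do {
           t \<leftarrow> op1 (slope z);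
           t' \<leftarrow> op1 (slope z');
           m \<leftarrow> op1 (slope r);
           above \<leftarrow> op1 (t > t');
           if above then do {
             Q \<leftarrow> op1 (Q @ [(t, m, 1)]);
             Q \<leftarrow> op1 (Q @ [(m, t', 0)]);
             ret (Q, lam, best)
           } else do {
             Q \<leftarrow> op1 (Q @ [(t', m, 1)]);
             Q \<leftarrow> op1 (Q @ [(m, t, 0)]);
             ret (Q, lam, best)
           }
         }
       }
   })"

(* The first argument is the number of iterations that may still be made; keeping track of
   it and testing the queue for emptiness are one operation each. *)
primrec search_loop ::
    "nat \<Rightarrow> ('y \<Rightarrow> real) \<Rightarrow> ('y \<Rightarrow> real) \<Rightarrow> 'y cone_oracle \<Rightarrow> 'y cone_oracle \<Rightarrow> 'y state \<Rightarrow> 'y option comp"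
where
  "search_loop 0 h g Oc Ou st = ret (snd (snd st))"
| "search_loop (Suc k) h g Oc Ou st = do {
     empty \<leftarrow> op1 (fst st = []);
     if empty then ret (snd (snd st))
     else do {
       st' \<leftarrow> iteration h g Oc Ou st;
       k' \<leftarrow> op1 k;
       search_loop k h g Oc Ou st'
     }
   }"

definition angular_search ::
    "('y \<Rightarrow> real) \<Rightarrow> ('y \<Rightarrow> real) \<Rightarrow> 'y cone_oracle \<Rightarrow> 'y cone_oracle \<Rightarrow>
     real \<Rightarrow> real \<Rightarrow> real \<Rightarrow> nat \<Rightarrow> 'y option comp" where
  "angular_search h g Oc Ou lam\<^sub>0 \<alpha>\<^sub>0 \<beta>\<^sub>0 max_iter = do {
     lam \<leftarrow> op1 lam\<^sub>0;
     best \<leftarrow> op1 None;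
     Q \<leftarrow> op1 [(\<alpha>\<^sub>0, \<beta>\<^sub>0, 0)];
     search_loop max_iter h g Oc Ou (Q, lam, best)
   }"

(* The number of iterations granted by a real bound T: as many as fit into T.  The search
   cannot find anything without a query, so it is granted one query if T < 1. *)
definition iteration_budget :: "real \<Rightarrow> nat" where
  "iteration_budget T = max 1 (nat \<lfloor>T\<rfloor>)"

end

theory Submission
  imports Defs
begin

text \<open>
  On a logarithmic scale for the slope \<open>g / h\<close>, the point \<open>1 / \<lambda>\<close> is the midpoint of the
  cone \<open>(\<alpha>, \<beta>)\<close>.  If the answer \<open>y\<close> has slope at distance \<open>w\<close> from it, then no label of the
  cone outside the open interval of radius \<open>w\<close> around the midpoint has a larger \<open>\<Phi>\<close>, and
  \<open>\<Phi> y\<close> is at least \<open>1 - tanh\<^sup>2 (w / 2)\<close> times the best value in the cone.  Hence, as long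
  as no optimal label was found, \<open>y\<^sup>*\<close> lies in a cone of the queue, and each time this cone is
  processed its log-width is at least halved.  The queue is first-in first-out and every
  iteration adds at most two cones, so this cone is processed for the \<open>(e + 1)\<close>-st time within the
  first \<open>2 ^ (e + 1) - 1\<close> iterations; log-width \<open>2 * \<epsilon>\<close> is enough for an \<open>\<epsilon>\<close>-optimal answer, and
  the initial log-width is \<open>2 * ln (G * H / \<phi>)\<close>.
\<close>

section \<open>Effect and cost of a single iteration\<close>

definition region :: "'y set \<Rightarrow> ('y \<Rightarrow> real) \<Rightarrow> ('y \<Rightarrow> real) \<Rightarrow> real \<times> real \<times> nat \<Rightarrow> 'y set" where
  "region Y h g = (\<lambda>(\<alpha>, \<beta>, s). if s = 0 then cone Y h g \<alpha> \<beta> else cone_swapped Y h g \<alpha> \<beta>)"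

text \<open>The slope \<open>m\<close> of \<open>r\<close> stays a quotient of square roots, as
  \<open>points\<close> yields it, so that \<open>iteration_outcome\<close> holds without sign
  conditions. For positive \<open>h y\<close>, \<open>g y\<close> and \<open>lam\<close> it is
  \<open>1 / lam\<close>.\<close>

definition children ::
    "('y \<Rightarrow> real) \<Rightarrow> ('y \<Rightarrow> real) \<Rightarrow> real \<Rightarrow> 'y option \<Rightarrow> (real \<times> real \<times> nat) list" where
  "children h g lam answer = (case answer of None \<Rightarrow> [] | Some y \<Rightarrow>
     let t = g y / h y; t' = (1 / lam * h y) / (lam * g y);
         m = sqrt (1 / lam * h y * g y) / sqrt (lam * h y * g y)
     in if h y = lam * g y then []
        else if t > t' then [(t, m, 1), (m, t', 0)] else [(t', m, 1), (m, t, 0)])"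

definition update :: "('y \<Rightarrow> real) \<Rightarrow> ('y \<Rightarrow> real) \<Rightarrow> 'y option \<Rightarrow> 'y option \<Rightarrow> 'y option" where
  "update h g best answer = (case answer of None \<Rightarrow> best | Some y \<Rightarrow>
     (case best of None \<Rightarrow> Some y | Some b \<Rightarrow> if Phi h g y > Phi h g b then Some y else best))"

lemma comp_simps [simp]:
  "outcome (op1 x) = x" "queries (op1 x) = 0" "operations (op1 x) = 1"
  "outcome (ret x) = x" "queries (ret x) = 0" "operations (ret x) = 0"
  "outcome (query x) = x" "queries (query x) = 1" "operations (query x) = 1"
  "outcome (bind_comp c f) = outcome (f (outcome c))"
  "queries (bind_comp c f) = queries c + queries (f (outcome c))"
  "operations (bind_comp c f) = operations c + operations (f (outcome c))"
  by (simp_all add: bind_comp_def op1_def ret_def query_def Let_def)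

lemma improves_simps [simp]:
  "outcome (improves h g y best) \<longleftrightarrow>
    (case best of None \<Rightarrow> True | Some b \<Rightarrow> Phi h g y > Phi h g b)"
  "queries (improves h g y best) = 0"
  "operations (improves h g y best) = (if best = None then 1 else 7)"
  by (simp_all add: improves_def Phi_def split: option.split)

lemma points_simps [simp]:
  "outcome (points h g lam y) = ((h y, g y), (lam * g y, 1 / lam * h y),
    (sqrt (lam * h y * g y), sqrt (1 / lam * h y * g y)))"
  "queries (points h g lam y) = 0"
  "operations (points h g lam y) = 11"
  by (simp_all add: points_def)

lemma iteration_outcome:
  "outcome (iteration h g Oc Ou ((\<alpha>, \<beta>, s) # Q, lam, best)) =
     (let lam' = (if \<beta> \<noteq> 0 then 1 / sqrt (\<alpha> * \<beta>) else lam);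
          answer = (if s = 0 then Oc lam' \<alpha> \<beta> else Ou lam' \<alpha> \<beta>)
      in (Q @ children h g lam' answer, lam', update h g best answer))"
proof -
  define c where "c = (if \<beta> \<noteq> 0 then do { p \<leftarrow> op1 (\<alpha> * \<beta>); q \<leftarrow> op1 (sqrt p); op1 (1 / q) }
    else ret lam)"
  define l where "l = (if \<beta> \<noteq> 0 then 1 / sqrt (\<alpha> * \<beta>) else lam)"
  define answer where "answer = (if s = 0 then Oc l \<alpha> \<beta> else Ou l \<alpha> \<beta>)"
  have c: "outcome c = l"
    by (simp add: c_def l_def)
  have best': "outcome (if b then op1 (Some y) else ret best) = (if b then Some y else best)" for b y
    by simp
  show ?thesis
    unfolding iteration_def prod.case list.sel comp_simps c_def[symmetric] Let_def l_def[symmetric]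
    unfolding c answer_def[symmetric]
    by (cases answer; cases best) (simp_all add: best' children_def update_def slope_def Let_def)
qed

text \<open>The 33 operations are 7 up to and including the query, 8 for comparing and recording the
  answer, 11 for the three points, 1 for the tie test and 6 for splitting the cone.\<close>

lemma iteration_cost:
  "queries (iteration h g Oc Ou ((\<alpha>, \<beta>, s) # Q, lam, best)) = 1"
  "operations (iteration h g Oc Ou ((\<alpha>, \<beta>, s) # Q, lam, best)) \<le> 33"
proof -
  define c where "c = (if \<beta> \<noteq> 0 then do { p \<leftarrow> op1 (\<alpha> * \<beta>); q \<leftarrow> op1 (sqrt p); op1 (1 / q) }
    else ret lam)"
  define answer where
    "answer = (if s = 0 then Oc (outcome c) \<alpha> \<beta> else Ou (outcome c) \<alpha> \<beta>)"
  have c: "queries c = 0" "operations c \<le> 3"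
    by (simp_all add: c_def)
  show "queries (iteration h g Oc Ou ((\<alpha>, \<beta>, s) # Q, lam, best)) = 1"
    unfolding iteration_def prod.case list.sel comp_simps c_def[symmetric]
    unfolding answer_def[symmetric]
    by (cases answer) (simp_all add: c)
  show "operations (iteration h g Oc Ou ((\<alpha>, \<beta>, s) # Q, lam, best)) \<le> 33"
    unfolding iteration_def prod.case list.sel comp_simps c_def[symmetric]
    unfolding answer_def[symmetric]
    using c(2) by (cases answer) simp_all
qed

lemma length_children: "length (children h g lam answer) \<le> 2"
  by (auto simp: children_def Let_def split: option.split)

lemma search_loop_Nil: "outcome (search_loop k h g Oc Ou ([], lam, best)) = best"
  by (cases k) auto

lemma search_loop_Cons:
  "outcome (search_loop (Suc k) h g Oc Ou (x # Q, lam, best)) =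
     outcome (search_loop k h g Oc Ou (outcome (iteration h g Oc Ou (x # Q, lam, best))))"
  by simp

text \<open>Testing the queue and counting down add 2 to the 33 operations of an iteration.\<close>

lemma search_loop_cost:
  "queries (search_loop k h g Oc Ou st) \<le> k \<and> operations (search_loop k h g Oc Ou st) \<le> 35 * k"
proof (induction k arbitrary: st)
  case 0
  show ?case by simp
next
  case (Suc k)
  show ?case
  proof (cases "fst st")
    case Nil
    then show ?thesis by simp
  next
    case (Cons x Q)
    then obtain \<alpha> \<beta> s lam best where st: "st = ((\<alpha>, \<beta>, s) # Q, lam, best)"
      by (metis prod.collapse)
    show ?thesis
      using Suc[of "outcome (iteration h g Oc Ou st)"]
        iteration_cost(2)[of h g Oc Ou \<alpha> \<beta> s Q lam best]
      by (simp add: st iteration_cost(1))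
  qed
qed

section \<open>Inequalities for two pairs of positive reals\<close>

text \<open>Here \<open>a\<close>, \<open>b\<close> stand for \<open>h y\<close>,
  \<open>lam * g y\<close> of the answer and \<open>p\<close>, \<open>q\<close> for those of a
  competitor. By AM-GM, \<open>4 * (p * q)\<close> is at most \<open>(a + b)\<^sup>2\<close>, of
  which \<open>4 * (a * b)\<close> is exactly the stated fraction. For \<open>b / a = exp w\<close>
  the ratio \<open>(b - a) / (a + b)\<close> is tanh (w / 2).\<close>

lemma linear_max_imp_product_bound:
  fixes a b p q :: real
  assumes "0 < a" "0 < b" "0 < p" "0 < q" "p + q \<le> a + b"
  shows "(1 - ((b - a) / (a + b))\<^sup>2) * (p * q) \<le> a * b"
proof -
  have "4 * (p * q) \<le> (p + q)\<^sup>2"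
    using sum_squares_ge_zero[of "p - q" 0] by (simp add: power2_eq_square algebra_simps)
  also have "\<dots> \<le> (a + b)\<^sup>2"
    using assms by (intro power_mono) auto
  finally have pq: "4 * (p * q) \<le> (a + b)\<^sup>2" .
  have r: "(1 - ((b - a) / (a + b))\<^sup>2) * (a + b)\<^sup>2 = 4 * (a * b)"
    using assms by (simp add: left_diff_distrib power_divide) (simp add: power2_eq_square algebra_simps)
  have "((b - a) / (a + b))\<^sup>2 \<le> 1"
    using assms by (simp add: abs_square_le_1 abs_le_iff divide_le_eq le_divide_eq)
  then have "(1 - ((b - a) / (a + b))\<^sup>2) * (4 * (p * q)) \<le> (1 - ((b - a) / (a + b))\<^sup>2) * (a + b)\<^sup>2"
    using pq by (intro mult_left_mono) auto
  with r show ?thesis by simp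
qed

text \<open>The product equals \<open>(q - p)\<^sup>2 * (a * b) - (b - a)\<^sup>2 * (p * q)\<close>,
  and a larger product with no larger sum forces a smaller difference. The sign says that the slope
  \<open>q / p\<close> lies strictly between \<open>b / a\<close> and its mirror image
  \<open>a / b\<close>.\<close>

lemma linear_max_imp_slope_between:
  fixes a b p q :: real
  assumes "0 < a" "0 < b" "0 < p" "0 < q" "p + q \<le> a + b" "a * b < p * q"
  shows "(q * a - b * p) * (q * b - a * p) < 0"
proof -
  have "(p + q)\<^sup>2 \<le> (a + b)\<^sup>2"
    using assms by (intro power_mono) auto
  then have less: "(q - p)\<^sup>2 < (b - a)\<^sup>2"
    using assms(6) by (simp add: power2_eq_square algebra_simps)
  have "(q - p)\<^sup>2 * (a * b) \<le> (q - p)\<^sup>2 * (p * q)"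
    using assms by (intro mult_left_mono) auto
  also have "\<dots> < (b - a)\<^sup>2 * (p * q)"
    using less assms by (intro mult_strict_right_mono) auto
  finally show ?thesis
    by (simp add: power2_eq_square algebra_simps)
qed

text \<open>Shrinking the denominator to the larger number leaves
  \<open>1 - x / y \<le> ln (y / x)\<close>. This replaces tanh (w / 2) by \<open>w\<close>.\<close>

lemma relative_difference_le_ln:
  fixes a b :: real
  assumes "0 < a" "0 < b"
  shows "\<bar>b - a\<bar> / (a + b) \<le> \<bar>ln b - ln a\<bar>"
proof -
  have *: "(y - x) / (x + y) \<le> ln y - ln x" if "0 < x" "x \<le> y" for x y :: real
  proof -
    have "(y - x) / (x + y) \<le> (y - x) / y"
      using that by (intro divide_left_mono) auto
    also have "\<dots> \<le> ln y - ln x"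
      using ln_diff_le[of x y] that by (simp add: field_simps)
    finally show ?thesis .
  qed
  show ?thesis
    using *[of a b] *[of b a] assms by (cases "a \<le> b") (auto simp: add.commute)
qed

text \<open>Serves the counting of queue positions, with \<open>p\<close> a power of two: every unit
  by which \<open>c\<close> falls short of \<open>m\<close> frees \<open>p\<close>, which pays for
  one unit of \<open>d\<close>.\<close>

lemma add_mult_le_mult:
  fixes n c d m p :: nat
  assumes "c + d \<le> m" "1 \<le> p"
  shows "(n + c) * p + d \<le> (n + m) * p"
proof -
  have "(n + c) * p + d * 1 \<le> (n + c) * p + d * p"
    using assms by (intro add_left_mono mult_left_mono) auto
  also have "\<dots> = (n + (c + d)) * p" by (simp add: algebra_simps)
  also have "\<dots> \<le> (n + m) * p"
    using assms by (intro mult_right_mono add_left_mono) auto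
  finally show ?thesis by simp
qed

section \<open>Answers of the oracles\<close>

lemma lambda_oracle_cases:
  assumes "lambda_oracle F h g ora"
  shows "case ora lam \<alpha> \<beta> of None \<Rightarrow> F \<alpha> \<beta> = {}
    | Some y \<Rightarrow> is_arg_max (\<lambda>y. h y + lam * g y) (\<lambda>y. y \<in> F \<alpha> \<beta>) y"
  by (rule assms[unfolded lambda_oracle_def, rule_format])

lemma lambda_oracle_None: "lambda_oracle F h g ora \<Longrightarrow> ora lam \<alpha> \<beta> = None \<Longrightarrow> F \<alpha> \<beta> = {}"
  by (drule lambda_oracle_cases[where lam = lam and \<alpha> = \<alpha> and \<beta> = \<beta>]) simp

lemma lambda_oracle_Some:
  assumes "lambda_oracle F h g ora" "ora lam \<alpha> \<beta> = Some y"
  shows "y \<in> F \<alpha> \<beta>" "y' \<in> F \<alpha> \<beta> \<Longrightarrow> h y' + lam * g y' \<le> h y + lam * g y"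
proof -
  have "is_arg_max (\<lambda>y. h y + lam * g y) (\<lambda>y. y \<in> F \<alpha> \<beta>) y"
    using lambda_oracle_cases[OF assms(1), where lam = lam and \<alpha> = \<alpha> and \<beta> = \<beta>] assms(2) by simp
  then show "y \<in> F \<alpha> \<beta>" "y' \<in> F \<alpha> \<beta> \<Longrightarrow> h y' + lam * g y' \<le> h y + lam * g y"
    by (auto simp: is_arg_max_def not_less)
qed

locale angular =
  fixes Y :: "'y set" and h g :: "'y \<Rightarrow> real" and Oc Ou :: "'y cone_oracle" and ystar :: 'y
  assumes g_nonneg: "y \<in> Y \<Longrightarrow> 0 \<le> g y"
    and Oc: "lambda_oracle (cone Y h g) h g Oc"
    and Ou: "lambda_oracle (cone_swapped Y h g) h g Ou"
    and ystar_in: "ystar \<in> Y"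
    and Phi_ystar_pos: "0 < Phi h g ystar"
begin

lemma g_ystar_pos: "0 < g ystar" and h_ystar_pos: "0 < h ystar"
  using g_nonneg[OF ystar_in] Phi_ystar_pos by (auto simp: Phi_def zero_less_mult_iff)

definition ask :: "real \<Rightarrow> real \<times> real \<times> nat \<Rightarrow> 'y option" where
  "ask lam = (\<lambda>(\<alpha>, \<beta>, s). if s = 0 then Oc lam \<alpha> \<beta> else Ou lam \<alpha> \<beta>)"

lemma ask_None: "ask lam x = None \<Longrightarrow> region Y h g x = {}"
  using lambda_oracle_None[OF Oc] lambda_oracle_None[OF Ou]
  by (auto simp: ask_def region_def split: prod.splits if_splits)

lemma ask_Some:
  assumes "ask lam x = Some y"
  shows "y \<in> region Y h g x"
    and "y' \<in> region Y h g x \<Longrightarrow> h y' + lam * g y' \<le> h y + lam * g y"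
  using assms lambda_oracle_Some[OF Oc] lambda_oracle_Some[OF Ou]
  by (auto simp: ask_def region_def split: prod.splits if_splits)

section \<open>Cones on the logarithmic slope scale\<close>

lemma region_subset: "region Y h g x \<subseteq> Y"
  by (auto simp: region_def cone_def cone_swapped_def split: prod.splits if_splits)

text \<open>Since \<open>g\<close> is nonnegative, the bound by \<open>\<alpha>\<close> excludes
  negative \<open>h y\<close>. One of the two bounds is strict, which excludes
  \<open>h y = 0\<close>.\<close>

lemma region_bounds:
  assumes "y \<in> region Y h g (\<alpha>, \<beta>, s)" "0 < \<alpha>" "0 < \<beta>"
  shows "0 < h y" "0 < g y" "\<beta> * h y \<le> g y" "g y \<le> \<alpha> * h y"
proof -
  have "0 \<le> g y" using assms(1) region_subset g_nonneg by blast
  have *: "\<beta> * h y \<le> g y" "g y \<le> \<alpha> * h y" "\<beta> * h y < g y \<or> g y < \<alpha> * h y"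
    using assms(1) by (auto simp: region_def cone_def cone_swapped_def split: if_splits)
  have "h y \<noteq> 0" using * by auto
  moreover have "0 \<le> h y"
    using * \<open>0 \<le> g y\<close> \<open>0 < \<alpha>\<close> by (metis order_trans zero_le_mult_iff not_less)
  ultimately show "0 < h y" by simp
  then show "0 < g y" using *(1) \<open>0 < \<beta>\<close> by (metis mult_pos_pos less_le_trans)
  show "\<beta> * h y \<le> g y" "g y \<le> \<alpha> * h y" by fact+
qed

text \<open>The left side is the distance \<open>w\<close> of the logarithmic slope of
  \<open>y\<close> from the midpoint \<open>- ln lam\<close> of the cone.\<close>

lemma answer_log_slope:
  assumes "y \<in> region Y h g (\<alpha>, \<beta>, s)" "0 < \<alpha>" "0 < \<beta>" "lam = 1 / sqrt (\<alpha> * \<beta>)"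
  shows "\<bar>ln (lam * g y) - ln (h y)\<bar> \<le> (ln \<alpha> - ln \<beta>) / 2"
proof -
  note b = region_bounds[OF assms(1-3)]
  have "ln (sqrt (\<alpha> * \<beta>)) = (ln \<alpha> + ln \<beta>) / 2"
    using assms by (simp add: ln_sqrt ln_mult_pos)
  then have "ln lam = - ((ln \<alpha> + ln \<beta>) / 2)"
    using assms by (simp add: ln_div)
  moreover have "0 < lam" using assms by simp
  moreover have "ln \<beta> + ln (h y) \<le> ln (g y)" "ln (g y) \<le> ln \<alpha> + ln (h y)"
    using b assms by (simp_all flip: ln_mult_pos)
  ultimately show ?thesis
    using b by (simp add: ln_mult_pos abs_le_iff) argo
qed

lemma answer_eps_optimal:
  assumes "ystar \<in> region Y h g (\<alpha>, \<beta>, s)" "0 < \<alpha>" "0 < \<beta>" "lam = 1 / sqrt (\<alpha> * \<beta>)"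
    and y: "ask lam (\<alpha>, \<beta>, s) = Some y"
    and "ln \<alpha> - ln \<beta> \<le> 2 * \<epsilon>"
  shows "(1 - \<epsilon>) * Phi h g ystar \<le> Phi h g y"
proof -
  have lam: "0 < lam" using assms by simp
  note b = region_bounds[OF ask_Some(1)[OF y] assms(2,3)]
  \<comment> \<open>This is tanh (w / 2), hence \<open>r \<le> w \<le> \<epsilon>\<close>; with
    \<open>r \<le> 1\<close> its square is at most \<open>\<epsilon>\<close> too.\<close>
  define r where "r = \<bar>lam * g y - h y\<bar> / (h y + lam * g y)"
  have "r \<le> \<epsilon>"
    using relative_difference_le_ln[of "h y" "lam * g y"] lam b
      answer_log_slope[OF ask_Some(1)[OF y] assms(2-4)] assms(6) by (simp add: r_def)
  moreover have "0 \<le> r" "r \<le> 1"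
    using lam b by (auto simp: r_def divide_le_eq abs_le_iff add_pos_pos mult_pos_pos)
  ultimately have "r\<^sup>2 \<le> \<epsilon>"
    by (smt (verit) power2_eq_square mult_left_le)
  have "(1 - r\<^sup>2) * (h ystar * (lam * g ystar)) \<le> h y * (lam * g y)"
    using linear_max_imp_product_bound[of "h y" "lam * g y" "h ystar" "lam * g ystar"]
      lam b h_ystar_pos g_ystar_pos ask_Some(2)[OF y assms(1)]
    by (simp add: r_def power_divide)
  then have "(1 - r\<^sup>2) * Phi h g ystar \<le> Phi h g y"
    using lam by (simp add: Phi_def mult.left_commute[of _ lam])
  moreover have "(1 - \<epsilon>) * Phi h g ystar \<le> (1 - r\<^sup>2) * Phi h g ystar"
    using \<open>r\<^sup>2 \<le> \<epsilon>\<close> Phi_ystar_pos by (intro mult_right_mono) auto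
  ultimately show ?thesis by linarith
qed

text \<open>On the logarithmic scale \<open>t\<close> and \<open>t'\<close> are mirror images about
  \<open>m\<close>, so both children have width \<open>w\<close>, at most half the old width. A
  better \<open>ystar\<close> lies strictly between \<open>t\<close> and \<open>t'\<close>; hence
  both outer rays may be open, while the ray of slope \<open>m\<close> belongs to both
  children.\<close>

lemma ystar_in_child:
  assumes "ystar \<in> region Y h g (\<alpha>, \<beta>, s)" "0 < \<alpha>" "0 < \<beta>" "lam = 1 / sqrt (\<alpha> * \<beta>)"
    and y: "ask lam (\<alpha>, \<beta>, s) = Some y"
    and worse: "Phi h g y < Phi h g ystar"
  obtains \<alpha>' \<beta>' s' where "(\<alpha>', \<beta>', s') \<in> set (children h g lam (Some y))"
    "ystar \<in> region Y h g (\<alpha>', \<beta>', s')" "0 < \<alpha>'" "0 < \<beta>'" "ln \<alpha>' - ln \<beta>' \<le> (ln \<alpha> - ln \<beta>) / 2"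
proof -
  have lam: "0 < lam" using assms by simp
  note b = region_bounds[OF ask_Some(1)[OF y] assms(2,3)]
  define t where "t = g y / h y"
  define t' where "t' = h y / (lam\<^sup>2 * g y)"
  define m where "m = 1 / lam"
  have pos: "0 < t" "0 < t'" "0 < m"
    using lam b by (auto simp: t_def t'_def m_def)
  have ln: "ln t = ln (g y) - ln (h y)" "ln t' = ln (h y) - 2 * ln lam - ln (g y)" "ln m = - ln lam"
    using lam b by (simp_all add: t_def t'_def m_def ln_div ln_mult_pos ln_realpow)
  have width: "\<bar>ln (g y) + ln lam - ln (h y)\<bar> \<le> (ln \<alpha> - ln \<beta>) / 2"
    using answer_log_slope[OF ask_Some(1)[OF y] assms(2-4)] lam b by (simp add: ln_mult_pos add.commute)
  have widths: "ln t - ln m \<le> (ln \<alpha> - ln \<beta>) / 2" "ln m - ln t' \<le> (ln \<alpha> - ln \<beta>) / 2"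
    "ln t' - ln m \<le> (ln \<alpha> - ln \<beta>) / 2" "ln m - ln t \<le> (ln \<alpha> - ln \<beta>) / 2"
    using width unfolding ln abs_le_iff by linarith+
  have r: "sqrt (1 / lam * h y * g y) / sqrt (lam * h y * g y) = m"
  proof -
    have "(1 / lam * h y * g y) / (lam * h y * g y) = m\<^sup>2"
      using lam b by (simp add: m_def field_simps power2_eq_square)
    then show ?thesis
      using pos by (simp flip: real_sqrt_divide)
  qed
  have "lam * (h y * g y) < lam * (h ystar * g ystar)"
    using worse lam by (simp add: Phi_def)
  then have between: "(lam * g ystar * h y - lam * g y * h ystar)
      * (lam * g ystar * (lam * g y) - h y * h ystar) < 0"
    using linear_max_imp_slope_between[of "h y" "lam * g y" "h ystar" "lam * g ystar"]
      lam b h_ystar_pos g_ystar_pos ask_Some(2)[OF y assms(1)]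
    by (simp add: mult.left_commute)
  \<comment> \<open>The factors in \<open>between\<close> have opposite signs. Their difference has
    the sign of \<open>lam * g y - h y\<close>, which tells which of them is negative.\<close>
  have sum: "(lam * g ystar * (lam * g y) - h y * h ystar) - (lam * g ystar * h y - lam * g y * h ystar)
      = (lam * g ystar + h ystar) * (lam * g y - h y)"
    by (simp add: algebra_simps)
  have sum_pos: "0 < lam * g ystar + h ystar"
    using lam h_ystar_pos g_ystar_pos by (simp add: add_pos_pos)
  \<comment> \<open>In a tie the two factors coincide and their product would be a square.\<close>
  have ne: "h y \<noteq> lam * g y"
    using between by (auto simp: not_less mult.commute)
  have t_less: "g ystar < t * h ystar \<longleftrightarrow> lam * g ystar * h y - lam * g y * h ystar < 0"
    and t_greater: "t * h ystar < g ystar \<longleftrightarrow> 0 < lam * g ystar * h y - lam * g y * h ystar"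
    using lam b by (auto simp: t_def field_simps)
  have t'_less: "t' * h ystar < g ystar \<longleftrightarrow> 0 < lam * g ystar * (lam * g y) - h y * h ystar"
    and t'_greater: "g ystar < t' * h ystar \<longleftrightarrow> lam * g ystar * (lam * g y) - h y * h ystar < 0"
    using lam b by (auto simp: t'_def field_simps power2_eq_square)
  have tt': "t' < t \<longleftrightarrow> h y < lam * g y"
  proof -
    have "t' < t \<longleftrightarrow> (h y)\<^sup>2 < (lam * g y)\<^sup>2"
      using lam b by (simp add: t_def t'_def field_simps power2_eq_square)
    also have "\<dots> \<longleftrightarrow> h y < lam * g y"
      using lam b by (simp add: not_le[symmetric])
    finally show ?thesis .
  qed
  show thesis
  proof (cases "h y < lam * g y")
    case True
    then have "0 < (lam * g ystar + h ystar) * (lam * g y - h y)"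
      using sum_pos by simp
    then have "g ystar < t * h ystar" "t' * h ystar < g ystar"
      using between[unfolded mult_less_0_iff] sum unfolding t_less t'_less by linarith+
    moreover have "children h g lam (Some y) = [(t, m, 1), (m, t', 0)]"
      using True tt' ne r by (simp add: children_def Let_def t_def t'_def power2_eq_square mult.assoc)
    ultimately show thesis
      using that[of t m 1] that[of m t' 0] pos widths ystar_in
      by (cases "m * h ystar \<le> g ystar") (auto simp: region_def cone_def cone_swapped_def)
  next
    case False
    then have "(lam * g ystar + h ystar) * (lam * g y - h y) < 0"
      using sum_pos ne by (simp add: mult_less_0_iff)
    then have "g ystar < t' * h ystar" "t * h ystar < g ystar"
      using between[unfolded mult_less_0_iff] sum unfolding t_greater t'_greater by linarith+
    moreover have "children h g lam (Some y) = [(t', m, 1), (m, t, 0)]"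
      using False tt' ne r by (simp add: children_def Let_def t_def t'_def power2_eq_square mult.assoc)
    ultimately show thesis
      using that[of t' m 1] that[of m t 0] pos widths ystar_in
      by (cases "m * h ystar \<le> g ystar") (auto simp: region_def cone_def cone_swapped_def)
  qed
qed

section \<open>Progress of the search loop\<close>

definition good :: "real \<Rightarrow> 'y option \<Rightarrow> bool" where
  "good \<epsilon> best \<longleftrightarrow> (\<exists>y\<in>Y. best = Some y \<and> (1 - \<epsilon>) * Phi h g ystar \<le> Phi h g y)"

text \<open>The cone followed below has \<open>\<beta> > 0\<close>, which fixes \<open>lam'\<close>.
  For any other cone, whatever \<open>lam'\<close> is, at most two children arise and
  \<open>best\<close> does not get worse.\<close>

lemma iteration_cases:
  obtains lam' where "outcome (iteration h g Oc Ou ((\<alpha>, \<beta>, s) # Q, lam, best)) =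
     (Q @ children h g lam' (ask lam' (\<alpha>, \<beta>, s)), lam', update h g best (ask lam' (\<alpha>, \<beta>, s)))"
    "\<beta> \<noteq> 0 \<longrightarrow> lam' = 1 / sqrt (\<alpha> * \<beta>)"
  by (rule that[of "if \<beta> \<noteq> 0 then 1 / sqrt (\<alpha> * \<beta>) else lam"])
    (auto simp: iteration_outcome Let_def ask_def)

lemma update_in: "set_option best \<subseteq> Y \<Longrightarrow> set_option (update h g best (ask lam x)) \<subseteq> Y"
  using ask_Some(1)[of lam x] region_subset[of x]
  by (auto simp: update_def split: option.splits if_splits)

lemma good_update: "good \<epsilon> best \<Longrightarrow> good \<epsilon> (update h g best (ask lam x))"
  using ask_Some(1)[of lam x] region_subset[of x]
  by (fastforce simp: update_def good_def split: option.splits)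

text \<open>If \<open>y\<close> does not replace the old best label, that label has at least the
  same \<open>Phi\<close>, and it lies in \<open>Y\<close> by the first premise.\<close>

lemma good_update_new:
  "set_option best \<subseteq> Y \<Longrightarrow> ask lam x = Some y \<Longrightarrow> (1 - \<epsilon>) * Phi h g ystar \<le> Phi h g y \<Longrightarrow>
    good \<epsilon> (update h g best (ask lam x))"
  using ask_Some(1)[of lam x] region_subset[of x]
  by (auto simp: update_def good_def split: option.splits)

lemma good_search_loop:
  "good \<epsilon> best \<Longrightarrow> good \<epsilon> (outcome (search_loop k h g Oc Ou (Q, lam, best)))"
proof (induction k arbitrary: Q lam best)
  case 0
  then show ?case by simp
next
  case (Suc k)
  show ?case
  proof (cases Q)
    case Nil
    then show ?thesis using Suc.prems by (simp add: search_loop_Nil del: search_loop.simps)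
  next
    case (Cons x Q')
    obtain \<alpha> \<beta> s where x: "x = (\<alpha>, \<beta>, s)" by (cases x)
    show ?thesis
      using iteration_cases[of \<alpha> \<beta> s Q' lam best] Suc.IH good_update[OF Suc.prems]
      by (metis Cons x search_loop_Cons)
  qed
qed

text \<open>The bound on \<open>k\<close> is the solution of the worst case recurrence: an iteration that
  processes another cone moves the cone of \<open>ystar\<close> up by one position and lengthens the queue by at
  most one, and processing the cone of \<open>ystar\<close> itself lowers \<open>e\<close> by one and moves it to the end.\<close>

lemma search_loop_good:
  assumes "0 < \<epsilon>" "set_option best \<subseteq> Y"
    and "ystar \<in> region Y h g (\<alpha>, \<beta>, s)" "0 < \<alpha>" "0 < \<beta>" "ln \<alpha> - ln \<beta> \<le> 2 ^ e * (2 * \<epsilon>)"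
    and "(length (A @ (\<alpha>, \<beta>, s) # B) + length A + 1) * 2 ^ e \<le> k + length (A @ (\<alpha>, \<beta>, s) # B)"
  shows "good \<epsilon> (outcome (search_loop k h g Oc Ou (A @ (\<alpha>, \<beta>, s) # B, lam, best)))"
  using assms(2-)
proof (induction k arbitrary: A B \<alpha> \<beta> s e lam best)
  case 0
  \<comment> \<open>Without iterations left the premise is contradictory: \<open>2 ^ e\<close> is at
    least 1, so its left side exceeds the queue length.\<close>
  have "(length (A @ (\<alpha>, \<beta>, s) # B) + length A + 1) * 1 \<le>
      (length (A @ (\<alpha>, \<beta>, s) # B) + length A + 1) * 2 ^ e"
    by (intro mult_left_mono) auto
  with 0 show ?case by simp
next
  case (Suc k)
  show ?case
  proof (cases A)
    case (Cons a A')
    obtain \<alpha>1 \<beta>1 s1 where a: "a = (\<alpha>1, \<beta>1, s1)" by (cases a)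
    obtain lam' where it: "outcome (iteration h g Oc Ou (A @ (\<alpha>, \<beta>, s) # B, lam, best)) =
       (A' @ (\<alpha>, \<beta>, s) # B @ children h g lam' (ask lam' a), lam', update h g best (ask lam' a))"
      using iteration_cases[of \<alpha>1 \<beta>1 s1 "A' @ (\<alpha>, \<beta>, s) # B" lam best] by (auto simp: Cons a)
    define c where "c = length (children h g lam' (ask lam' a))"
    have "c \<le> 2" by (simp add: c_def length_children)
    \<comment> \<open>Two children are the worst case: each missing one lowers the right side of the
      bound by 1 and the left side by \<open>2 ^ e\<close>.\<close>
    have "(2 * length A' + length B + 2 + c) * 2 ^ e + (2 - c)
        \<le> (2 * length A' + length B + 2 + 2) * 2 ^ e"
      using \<open>c \<le> 2\<close> by (intro add_mult_le_mult) auto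
    also have "\<dots> = (length (A @ (\<alpha>, \<beta>, s) # B) + length A + 1) * 2 ^ e"
      by (simp add: Cons)
    also have "\<dots> \<le> k + length A' + length B + 3"
      using Suc.prems(6) by (simp add: Cons)
    finally have "(2 * length A' + length B + 2 + c) * 2 ^ e \<le> k + length A' + length B + c + 1"
      using \<open>c \<le> 2\<close> by simp
    then have "good \<epsilon> (outcome (search_loop k h g Oc Ou
        (A' @ (\<alpha>, \<beta>, s) # B @ children h g lam' (ask lam' a), lam', update h g best (ask lam' a))))"
      using Suc.prems(1-5) update_in by (intro Suc.IH[where e = e]) (auto simp: c_def algebra_simps)
    then show ?thesis
      by (simp add: Cons search_loop_Cons it[unfolded Cons, simplified] del: search_loop.simps)
  next
    case Nil
    let ?x = "(\<alpha>, \<beta>, s)"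
    obtain lam' where it: "outcome (iteration h g Oc Ou (?x # B, lam, best)) =
       (B @ children h g lam' (ask lam' ?x), lam', update h g best (ask lam' ?x))"
      and lam': "lam' = 1 / sqrt (\<alpha> * \<beta>)"
      using iteration_cases[of \<alpha> \<beta> s B lam best] Suc.prems by auto
    obtain y where y: "ask lam' ?x = Some y"
      using ask_None[of lam' ?x] Suc.prems by fastforce
    have "good \<epsilon> (outcome (search_loop k h g Oc Ou
        (B @ children h g lam' (ask lam' ?x), lam', update h g best (ask lam' ?x))))"
    proof (cases "(1 - \<epsilon>) * Phi h g ystar \<le> Phi h g y")
      case True
      then show ?thesis
        using good_update_new[OF Suc.prems(1) y] by (intro good_search_loop) auto
    next
      case False
      \<comment> \<open>For \<open>e = 0\<close> the log-width is at most
        \<open>2 * \<epsilon>\<close> and the answer would be good.\<close>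
      then obtain d where e: "e = Suc d"
        using answer_eps_optimal[OF Suc.prems(2-4) lam' y, of \<epsilon>] Suc.prems(5) by (cases e) auto
      have "(1 - \<epsilon>) * Phi h g ystar \<le> Phi h g ystar"
        using Phi_ystar_pos \<open>0 < \<epsilon>\<close> by (simp add: algebra_simps)
      with False have "Phi h g y < Phi h g ystar" by linarith
      then obtain \<alpha>' \<beta>' s' where child: "(\<alpha>', \<beta>', s') \<in> set (children h g lam' (Some y))"
        "ystar \<in> region Y h g (\<alpha>', \<beta>', s')" "0 < \<alpha>'" "0 < \<beta>'" "ln \<alpha>' - ln \<beta>' \<le> (ln \<alpha> - ln \<beta>) / 2"
        by (rule ystar_in_child[OF Suc.prems(2-4) lam' y])
      obtain C D where CD: "children h g lam' (Some y) = C @ (\<alpha>', \<beta>', s') # D"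
        using child(1) by (meson split_list)
      have len: "length C + length D \<le> 1"
        using length_children[of h g lam' "Some y"] by (simp add: CD)
      \<comment> \<open>Halving the power doubles the coefficient \<open>length B + 2\<close>. This
        leaves room for the worst case, in which the child containing \<open>ystar\<close> comes
        second.\<close>
      have "(2 * length B + 2 + (2 * length C + length D)) * 2 ^ d + (1 - (length C + length D))
          \<le> (2 * length B + 2 + 2) * 2 ^ d"
        using len by (intro add_mult_le_mult) auto
      also have "\<dots> = (length (A @ (\<alpha>, \<beta>, s) # B) + length A + 1) * 2 ^ e"
        by (simp add: Nil e)
      also have "\<dots> \<le> k + length B + 2"
        using Suc.prems(6) by (simp add: Nil)
      finally have bound: "(2 * length B + 2 + (2 * length C + length D)) * 2 ^ d
          \<le> k + length B + length C + length D + 1"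
        using len by simp
      have "good \<epsilon> (outcome (search_loop k h g Oc Ou
          ((B @ C) @ (\<alpha>', \<beta>', s') # D, lam', update h g best (ask lam' ?x))))"
        using child Suc.prems(1,5) update_in bound
        by (intro Suc.IH[where e = d]) (auto simp: e algebra_simps)
      then show ?thesis by (simp add: y CD)
    qed
    then show ?thesis
      by (simp add: Nil search_loop_Cons it del: search_loop.simps)
  qed
qed

section \<open>The initial cone and the iteration budget\<close>

lemma angular_search_good:
  assumes "0 < \<phi>" "\<phi> < Phi h g ystar" "0 < \<epsilon>"
    and H: "\<And>y. y \<in> Y \<Longrightarrow> h y \<le> H" and G: "\<And>y. y \<in> Y \<Longrightarrow> g y \<le> G"
    and T: "T = 4 * ln (G * H / \<phi>) * (1 / \<epsilon>)"
  shows "good \<epsilon> (outcome (angular_search h g Oc Ou lam\<^sub>0 (G\<^sup>2 / \<phi>) (\<phi> / H\<^sup>2) (iteration_budget T)))"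
proof -
  have hH: "h ystar \<le> H" and gG: "g ystar \<le> G" using ystar_in H G by auto
  have pos: "0 < H" "0 < G" using hH gG h_ystar_pos g_ystar_pos by linarith+
  have "\<phi> < g ystar * h ystar" using assms(2) by (simp add: Phi_def mult.commute)
  \<comment> \<open>The slope of \<open>ystar\<close> is both
    \<open>(g ystar)\<^sup>2 / Phi h g ystar\<close> and
    \<open>Phi h g ystar / (h ystar)\<^sup>2\<close>; estimating these by \<open>G\<close>,
    \<open>H\<close> and \<open>\<phi>\<close> gives the two sides of the initial cone.\<close>
  have "\<phi> * g ystar \<le> (g ystar * h ystar) * g ystar"
    using \<open>\<phi> < g ystar * h ystar\<close> g_ystar_pos by (intro mult_right_mono) auto
  also have "\<dots> = g ystar * g ystar * h ystar" by simp
  also have "\<dots> \<le> G * G * h ystar"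
    using gG g_ystar_pos h_ystar_pos pos by (intro mult_right_mono mult_mono) auto
  finally have upper: "g ystar \<le> G\<^sup>2 / \<phi> * h ystar"
    using \<open>0 < \<phi>\<close> by (simp add: field_simps power2_eq_square)
  have "\<phi> * h ystar < (g ystar * h ystar) * h ystar"
    using \<open>\<phi> < g ystar * h ystar\<close> h_ystar_pos by (intro mult_strict_right_mono) auto
  also have "\<dots> = g ystar * (h ystar * h ystar)" by simp
  also have "\<dots> \<le> g ystar * (H * H)"
    using hH g_ystar_pos h_ystar_pos pos by (intro mult_left_mono mult_mono) auto
  finally have lower: "\<phi> / H\<^sup>2 * h ystar < g ystar"
    using pos by (simp add: field_simps power2_eq_square)
  have root: "ystar \<in> region Y h g (G\<^sup>2 / \<phi>, \<phi> / H\<^sup>2, 0)"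
    using upper lower ystar_in by (simp add: region_def cone_def)
  define L where "L = ln (G\<^sup>2 / \<phi>) - ln (\<phi> / H\<^sup>2)"
  have L: "T = 2 * L / \<epsilon>"
    using pos \<open>0 < \<phi>\<close> by (simp add: T L_def ln_div ln_mult_pos ln_realpow)
  \<comment> \<open>The least \<open>e\<close> for the first condition is taken; the second is the
    premise of \<open>search_loop_good\<close> for a queue of one cone.\<close>
  obtain e where e: "L \<le> 2 ^ e * (2 * \<epsilon>)" "2 * 2 ^ e \<le> iteration_budget T + 1"
  proof -
    define P where "P e \<longleftrightarrow> L \<le> 2 ^ e * (2 * \<epsilon>)" for e :: nat
    obtain n where "L / (2 * \<epsilon>) < 2 ^ n"
      using real_arch_pow[of 2 "L / (2 * \<epsilon>)"] by auto
    then have "P n" using \<open>0 < \<epsilon>\<close> by (simp add: P_def field_simps)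
    then have least: "P (LEAST e. P e)" by (rule LeastI)
    show thesis
    proof (cases "LEAST e. P e")
      case 0
      \<comment> \<open>One iteration is enough here, and the budget grants it even if
        \<open>T < 1\<close>.\<close>
      then show thesis using least that[of 0] by (simp add: P_def iteration_budget_def)
    next
      case (Suc d)
      then have "\<not> P d" using not_less_Least[of d P] by simp
      \<comment> \<open>Minimality gives \<open>L > 2 ^ d * (2 * \<epsilon>)\<close>, and
        \<open>T = 2 * L / \<epsilon>\<close> turns this into \<open>T > 4 * 2 ^ d\<close>.\<close>
      then have "real (2 * 2 ^ Suc d) \<le> T"
        using \<open>0 < \<epsilon>\<close> by (simp add: P_def L field_simps)
      then have "2 * 2 ^ Suc d \<le> nat \<lfloor>T\<rfloor>"
        by (simp add: le_nat_floor del: of_nat_mult of_nat_power)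
      then show thesis using least Suc that[of "Suc d"] by (simp add: P_def iteration_budget_def)
    qed
  qed
  have "good \<epsilon> (outcome (search_loop (iteration_budget T) h g Oc Ou
      ([] @ (G\<^sup>2 / \<phi>, \<phi> / H\<^sup>2, 0) # [], lam\<^sub>0, None)))"
    using root e pos assms(1,3) by (intro search_loop_good[where e = e]) (auto simp: L_def)
  then show ?thesis by (simp add: angular_search_def)
qed

end

section \<open>Total cost and the two guarantees\<close>

text \<open>The 3 initial assignments are absorbed by \<open>max 1 T \<ge> 1\<close>, whence 38 = 35
  + 3.\<close>

lemma angular_search_cost:
  shows "real (queries (angular_search h g Oc Ou lam\<^sub>0 \<alpha>\<^sub>0 \<beta>\<^sub>0 (iteration_budget T))) \<le> max 1 T"
    and "real (operations (angular_search h g Oc Ou lam\<^sub>0 \<alpha>\<^sub>0 \<beta>\<^sub>0 (iteration_budget T))) \<le> 38 * max 1 T"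
proof -
  have N: "real (iteration_budget T) \<le> max 1 T"
    by (simp add: iteration_budget_def) linarith
  note cost = search_loop_cost[of "iteration_budget T" h g Oc Ou "([(\<alpha>\<^sub>0, \<beta>\<^sub>0, 0)], lam\<^sub>0, None)"]
  show "real (queries (angular_search h g Oc Ou lam\<^sub>0 \<alpha>\<^sub>0 \<beta>\<^sub>0 (iteration_budget T))) \<le> max 1 T"
    using cost N by (simp add: angular_search_def)
  have "real (operations (angular_search h g Oc Ou lam\<^sub>0 \<alpha>\<^sub>0 \<beta>\<^sub>0 (iteration_budget T)))
      \<le> 35 * real (iteration_budget T) + 3"
    using cost by (simp add: angular_search_def)
  then show "real (operations (angular_search h g Oc Ou lam\<^sub>0 \<alpha>\<^sub>0 \<beta>\<^sub>0 (iteration_budget T))) \<le> 38 * max 1 T"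
    using N by (simp add: max_def split: if_splits)
qed

theorem theorem5:
  "\<exists>C::real. \<forall>(Y :: 'y set) (h :: 'y \<Rightarrow> real) (g :: 'y \<Rightarrow> real) (Oc :: 'y cone_oracle) (Ou :: 'y cone_oracle)
       (\<phi>::real) (H::real) (G::real) (ystar :: 'y).
     (\<forall>y\<in>Y. 0 \<le> g y) \<and>
     0 < \<phi> \<and>
     lambda_oracle (cone Y h g) h g Oc \<and>
     lambda_oracle (cone_swapped Y h g) h g Ou \<and>
     is_arg_max (Phi h g) (\<lambda>y. y \<in> Y) ystar \<and>
     H \<in> h ` Y \<and> (\<forall>y\<in>Y. h y \<le> H) \<and>
     G \<in> g ` Y \<and> (\<forall>y\<in>Y. g y \<le> G) \<and>
     Phi h g ystar > \<phi>
     \<longrightarrow>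
     (\<forall>\<epsilon>>(0::real). let T = 4 * ln (G * H / \<phi>) * (1 / \<epsilon>);
                run = angular_search h g Oc Ou (G / H) (G\<^sup>2 / \<phi>) (\<phi> / H\<^sup>2) (iteration_budget T)
            in (\<exists>y\<in>Y. outcome run = Some y \<and> Phi h g y \<ge> (1 - \<epsilon>) * Phi h g ystar) \<and>
               real (queries run) \<le> max 1 T \<and>
               real (operations run) \<le> C * max 1 T) \<and>
     (\<forall>\<delta>>(0::real). let T' = 4 * ln (G * H / \<phi>) * (Phi h g ystar / \<delta>);
                run = angular_search h g Oc Ou (G / H) (G\<^sup>2 / \<phi>) (\<phi> / H\<^sup>2) (iteration_budget T')
            in (\<exists>y\<in>Y. outcome run = Some y \<and> Phi h g y \<ge> Phi h g ystar - \<delta>) \<and>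
               real (queries run) \<le> max 1 T' \<and>
               real (operations run) \<le> C * max 1 T')"
proof (rule exI[of _ 38], intro allI impI, elim conjE)
  fix Y :: "'y set" and h g :: "'y \<Rightarrow> real" and Oc Ou :: "'y cone_oracle"
    and \<phi> H G :: real and ystar :: 'y
  assume asms: "\<forall>y\<in>Y. 0 \<le> g y" "0 < \<phi>"
    "lambda_oracle (cone Y h g) h g Oc" "lambda_oracle (cone_swapped Y h g) h g Ou"
    "is_arg_max (Phi h g) (\<lambda>y. y \<in> Y) ystar"
    "\<forall>y\<in>Y. h y \<le> H" "\<forall>y\<in>Y. g y \<le> G" "\<phi> < Phi h g ystar"
  interpret angular Y h g Oc Ou ystar
    using asms by unfold_locales (auto simp: is_arg_max_def)
  have good: "\<exists>y\<in>Y. outcome (angular_search h g Oc Ou (G / H) (G\<^sup>2 / \<phi>) (\<phi> / H\<^sup>2)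
        (iteration_budget (4 * ln (G * H / \<phi>) * (1 / \<epsilon>)))) = Some y \<and>
      (1 - \<epsilon>) * Phi h g ystar \<le> Phi h g y" if "0 < \<epsilon>" for \<epsilon>
    using angular_search_good[OF asms(2,8) that _ _ refl, of H G] asms by (auto simp: good_def)
  \<comment> \<open>The choice \<open>\<epsilon> = \<delta> / Phi h g ystar\<close> makes the
    relative error the absolute error \<open>\<delta>\<close> and turns
    \<open>1 / \<epsilon>\<close> into \<open>Phi h g ystar / \<delta>\<close>.\<close>
  have good': "\<exists>y\<in>Y. outcome (angular_search h g Oc Ou (G / H) (G\<^sup>2 / \<phi>) (\<phi> / H\<^sup>2)
        (iteration_budget (4 * ln (G * H / \<phi>) * (Phi h g ystar / \<delta>)))) = Some y \<and>
      Phi h g ystar - \<delta> \<le> Phi h g y" if "0 < \<delta>" for \<delta>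
    using good[of "\<delta> / Phi h g ystar"] that Phi_ystar_pos by (simp add: left_diff_distrib)
  show "(\<forall>\<epsilon>>(0::real). let T = 4 * ln (G * H / \<phi>) * (1 / \<epsilon>);
                run = angular_search h g Oc Ou (G / H) (G\<^sup>2 / \<phi>) (\<phi> / H\<^sup>2) (iteration_budget T)
            in (\<exists>y\<in>Y. outcome run = Some y \<and> Phi h g y \<ge> (1 - \<epsilon>) * Phi h g ystar) \<and>
               real (queries run) \<le> max 1 T \<and>
               real (operations run) \<le> 38 * max 1 T) \<and>
     (\<forall>\<delta>>(0::real). let T' = 4 * ln (G * H / \<phi>) * (Phi h g ystar / \<delta>);
                run = angular_search h g Oc Ou (G / H) (G\<^sup>2 / \<phi>) (\<phi> / H\<^sup>2) (iteration_budget T')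
            in (\<exists>y\<in>Y. outcome run = Some y \<and> Phi h g y \<ge> Phi h g ystar - \<delta>) \<and>
               real (queries run) \<le> max 1 T' \<and>
               real (operations run) \<le> 38 * max 1 T')"
    unfolding Let_def by (intro conjI allI impI good good' angular_search_cost)
qed

end
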